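(* Let $p$ be a prime with $p\equiv 15$ or $27\pmod{28}$. For all integers $m,n,k\geq 0$ with $p\nmid n$, \[ c_{13,1}\left(2^{3k+3}p^{2m+1}n+\frac{5\cdot 2^{3k+3}p^{2m+2}+9}{7}\right)\equiv 0\pmod 2. \]
   Context: For complex $a,b$ the false theta function is $\Psi(a,b):=\sum_{n=0}^\infty a^{n(n+1)/2}b^{n(n-1)/2}-\sum_{n=-\infty}^{-1}a^{n(n+1)/2}b^{n(n-1)/2}$. For positive integers $r,s$, the integers $c_{r,s}(n)$ ($n\ge 0$) are defined by the power series identity $\sum_{n=0}^\infty c_{r,s}(n)q^n=\dfrac{1}{\Psi(-q^r,q^s)}$ (the denominator is a power series in $q$ with constant term $1$). *)

theory Defs
  imports "HOL-Analysis.Analysis" "HOL-Number_Theory.Cong"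
begin

text \<open>
  The false theta function is defined over any commutative ring with a Hausdorff topology, so that
  the same series can be read for complex \<open>a\<close>, \<open>b\<close> and for formal power series \<open>a\<close>, \<open>b\<close> in \<open>q\<close>.
  For every integer \<open>n\<close> the numbers \<open>n(n+1)\<close> and \<open>n(n-1)\<close> are even and nonnegative, so neither
  \<open>div\<close> nor \<open>nat\<close> loses information.
\<close>

definition theta_term :: "'a::comm_ring_1 \<Rightarrow> 'a \<Rightarrow> int \<Rightarrow> 'a" where
  "theta_term a b n = a ^ nat (n * (n + 1) div 2) * b ^ nat (n * (n - 1) div 2)"

definition false_theta :: "'a::{comm_ring_1, t2_space} \<Rightarrow> 'a \<Rightarrow> 'a" where
  "false_theta a b = infsum (theta_term a b) {0..} - infsum (theta_term a b) {..-1}"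

text \<open>\<open>\<Psi>(-q\<^sup>r, q\<^sup>s)\<close> as a power series in \<open>q\<close>.\<close>

definition false_theta_fps :: "nat \<Rightarrow> nat \<Rightarrow> int fps" where
  "false_theta_fps r s = false_theta (- (fps_X ^ r)) (fps_X ^ s)"

text \<open>
  \<open>\<int>\<close> is not a field, so the defining identity is stated in multiplied-out form. The solution
  exists and is unique by \<open>Abs_fps_c_coeff\<close> and \<open>c_coeff_unique\<close> below.
\<close>

definition c_coeff :: "nat \<Rightarrow> nat \<Rightarrow> nat \<Rightarrow> int" where
  "c_coeff r s = (THE c. Abs_fps c * false_theta_fps r s = 1)"


lemma has_sum_fps:
  fixes f :: "int \<Rightarrow> int fps"
  assumes "\<And>i. finite {n \<in> A. fps_nth (f n) i \<noteq> 0}"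
  shows "(f has_sum Abs_fps (\<lambda>i. \<Sum>n | n \<in> A \<and> fps_nth (f n) i \<noteq> 0. fps_nth (f n) i)) A"
  unfolding has_sum_def
proof (rule tendsto_fpsI)
  fix i
  let ?S = "{n. n \<in> A \<and> fps_nth (f n) i \<noteq> 0}"
  have "\<forall>\<^sub>F F in finite_subsets_at_top A. finite F \<and> ?S \<subseteq> F \<and> F \<subseteq> A"
    using assms[of i] by (auto simp: eventually_finite_subsets_at_top)
  then show "\<forall>\<^sub>F F in finite_subsets_at_top A. fps_nth (sum f F) i =
      fps_nth (Abs_fps (\<lambda>i. \<Sum>n | n \<in> A \<and> fps_nth (f n) i \<noteq> 0. fps_nth (f n) i)) i"
  proof eventually_elim
    case (elim F)
    then have "(\<Sum>n\<in>?S. fps_nth (f n) i) = (\<Sum>n\<in>F. fps_nth (f n) i)"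
      by (intro sum.mono_neutral_left) auto
    then show ?case by (simp add: fps_sum_nth)
  qed
qed

definition theta_exp :: "nat \<Rightarrow> nat \<Rightarrow> int \<Rightarrow> nat" where
  "theta_exp r s n = r * nat (n * (n + 1) div 2) + s * nat (n * (n - 1) div 2)"

lemma theta_term_fps:
  "fps_nth (theta_term (- (fps_X ^ r)) (fps_X ^ s) n :: int fps) i =
     (if i = theta_exp r s n then (-1) ^ nat (n * (n + 1) div 2) else 0)"
proof -
  let ?e = "nat (n * (n + 1) div 2)"
  have "(- 1 :: int fps) ^ j = fps_const ((-1) ^ j)" for j
    by (induction j) (simp_all flip: fps_const_neg fps_const_mult)
  then have "(- (fps_X ^ r) :: int fps) ^ ?e = fps_const ((-1) ^ ?e) * fps_X ^ (r * ?e)"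
    by (subst power_minus) (simp only: power_mult)
  then have "(theta_term (- (fps_X ^ r)) (fps_X ^ s) n :: int fps) =
      fps_const ((-1) ^ ?e) * fps_X ^ theta_exp r s n"
    by (simp add: theta_term_def theta_exp_def power_add power_mult mult.assoc)
  then show ?thesis by (simp add: fps_X_power_nth)
qed

lemma theta_exp_ge:
  assumes "r > 0" "s > 0"
  shows "\<bar>n\<bar> \<le> int (theta_exp r s n)"
proof -
  let ?x = "n * (n + 1) div 2" and ?y = "n * (n - 1) div 2"
  have "2 * ?x = n * (n + 1)" "2 * ?y = n * (n - 1)" by auto
  then have "2 * ?x + 2 * ?y = 2 * (n * n)" unfolding right_diff_distrib distrib_left by linarith
  then have xy: "?x + ?y = n * n" by linarith
  have "\<bar>n\<bar> * 1 \<le> \<bar>n\<bar> * \<bar>n\<bar>"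
    by (cases "n = 0") (simp, intro mult_left_mono, auto)
  then have "\<bar>n\<bar> \<le> ?x + ?y" unfolding xy by simp
  also have "\<dots> \<le> int (1 * nat ?x + 1 * nat ?y)" by linarith
  also have "\<dots> \<le> int (theta_exp r s n)"
    unfolding theta_exp_def of_nat_le_iff using assms by (intro add_mono mult_right_mono) auto
  finally show ?thesis .
qed

lemma finite_theta_exp:
  assumes "r > 0" "s > 0"
  shows "finite {n. theta_exp r s n = i}"
proof (rule finite_subset)
  show "{n. theta_exp r s n = i} \<subseteq> {- int i..int i}"
    using theta_exp_ge[OF assms] by (auto simp: abs_le_iff) (smt (verit))+
qed simp

lemma false_theta_fps_nth:
  assumes "r > 0" "s > 0"
  shows "fps_nth (false_theta_fps r s) i =
    (\<Sum>n | n \<ge> 0 \<and> theta_exp r s n = i. (-1) ^ nat (n * (n + 1) div 2)) -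
    (\<Sum>n | n < 0 \<and> theta_exp r s n = i. (-1) ^ nat (n * (n + 1) div 2))"
proof -
  let ?f = "theta_term (- (fps_X ^ r)) (fps_X ^ s) :: int \<Rightarrow> int fps"
  have eq: "{n \<in> A. fps_nth (?f n) i \<noteq> 0} = {n \<in> A. theta_exp r s n = i}" for A i
    by (auto simp: theta_term_fps)
  have fin: "finite {n \<in> A. fps_nth (?f n) i \<noteq> 0}" for A i
    unfolding eq using finite_theta_exp[OF assms, of i] by (rule rev_finite_subset) auto
  have "fps_nth (infsum ?f A) i =
      (\<Sum>n | n \<in> A \<and> theta_exp r s n = i. (-1) ^ nat (n * (n + 1) div 2))" for A
    unfolding infsumI[OF has_sum_fps[OF fin]] by (auto simp: eq theta_term_fps intro!: sum.cong)
  from this[of "{0..}"] this[of "{..-1}"] show ?thesis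
    by (simp add: false_theta_fps_def false_theta_def zle_diff1_eq[symmetric])
qed

lemma false_theta_fps_nth_0:
  assumes "r > 0" "s > 0"
  shows "fps_nth (false_theta_fps r s) 0 = 1"
proof -
  have "theta_exp r s n = 0 \<longleftrightarrow> n = 0" for n
  proof
    show "theta_exp r s n = 0 \<Longrightarrow> n = 0" using theta_exp_ge[OF assms, of n] by simp
  qed (simp add: theta_exp_def)
  then have "{n. n \<ge> 0 \<and> theta_exp r s n = 0} = {0}" "{n. n < 0 \<and> theta_exp r s n = 0} = {}"
    by auto
  then show ?thesis by (simp only: false_theta_fps_nth[OF assms]) simp
qed

lemma c_coeff_unique:
  assumes "Abs_fps c * false_theta_fps r s = 1" "Abs_fps d * false_theta_fps r s = 1"
  shows "c = d"
proof -
  have "Abs_fps c = Abs_fps c * (Abs_fps d * false_theta_fps r s)" by (simp add: assms)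
  also have "\<dots> = Abs_fps d" using assms(1) by (simp add: mult.left_commute)
  finally show ?thesis by (simp add: fps_eq_iff fun_eq_iff)
qed

lemma Abs_fps_c_coeff:
  assumes "r > 0" "s > 0"
  shows "Abs_fps (c_coeff r s) * false_theta_fps r s = 1"
proof -
  have "false_theta_fps r s * fps_right_inverse (false_theta_fps r s) 1 = 1"
    by (rule fps_right_inverse) (simp add: false_theta_fps_nth_0[OF assms])
  then have "\<exists>c. Abs_fps c * false_theta_fps r s = 1" by (metis mult.commute)
  then show ?thesis
    unfolding c_coeff_def by (metis (mono_tags, lifting) c_coeff_unique theI)
qed

text \<open>The division by 7 in the statement is exact.\<close>

lemma seven_dvd:
  fixes p m k :: nat
  assumes "[p = 15] (mod 28) \<or> [p = 27] (mod 28)"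
  shows "7 dvd 5 * 2 ^ (3 * k + 3) * p ^ (2 * m + 2) + 9"
proof -
  have "[2 ^ 3 = 1] (mod 7 :: nat)" by (simp add: cong_def)
  then have 2: "[(2 ^ 3) ^ (k + 1) = 1 ^ (k + 1)] (mod 7 :: nat)" by (rule cong_pow)
  have "(p mod 28) mod 7 = p mod 7" by (simp add: mod_mod_cancel)
  then have "p mod 7 = 1 \<or> p mod 7 = 6" using assms by (auto simp: cong_def)
  then have "[p = 1] (mod 7) \<or> [p = 6] (mod 7)" by (simp add: cong_def)
  then have "[p ^ 2 = 1] (mod 7)"
  proof
    assume "[p = 1] (mod 7)"
    from cong_pow[OF this, of 2] show ?thesis by simp
  next
    assume "[p = 6] (mod 7)"
    from cong_pow[OF this, of 2] show ?thesis by (simp add: cong_def)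
  qed
  then have "[(p ^ 2) ^ (m + 1) = 1 ^ (m + 1)] (mod 7)" by (rule cong_pow)
  from cong_mult[OF 2 this] have "[2 ^ (3 * k + 3) * p ^ (2 * m + 2) = 1] (mod 7)"
    by (simp only: power_mult[symmetric] distrib_left mult_1_right power_one)
  then have "[5 * (2 ^ (3 * k + 3) * p ^ (2 * m + 2)) + 9 = 5 * 1 + 9] (mod 7)"
    by (intro cong_add cong_mult cong_refl)
  then show ?thesis by (simp add: cong_def mult.assoc mod_eq_0_iff_dvd)
qed

end

theory Submission
  imports Defs "HOL-Number_Theory.Residues" "HOL-Library.Z2"
begin

text \<open>
  Write \<open>A\<^sub>r\<close> for the sum of \<open>q^(x\<^sup>2)\<close> over the integers \<open>x\<close> congruent to \<open>r\<close> modulo 7, with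
  coefficients modulo 2. Completing the square in the exponents \<open>7n\<^sup>2 + 6n\<close> of \<open>\<Psi>(-q^13, q)\<close> gives
  \<open>C A\<^sub>3 = q^9\<close>, where \<open>C\<close> is the sum of \<open>c(j) q^(7j)\<close>. By the Frobenius identity
  \<open>f(q)^8 = f(q^8)\<close> this becomes \<open>C(q) A\<^sub>3(q^8) = q^9 A\<^sub>3(q) A\<^sub>3(q^2) A\<^sub>3(q^4)\<close>. The terms of
  the ternary theta series on the right with exponent divisible by 8 form
  \<open>(A\<^sub>1 A\<^sub>2 A\<^sub>3)(q^8)\<close>, so after cancelling \<open>A\<^sub>3\<close>, if \<open>7j = 8s + 9\<close> then \<open>c(j)\<close> has the parity
  of the number of representations \<open>s = x\<^sup>2 + y\<^sup>2\<close> with \<open>x\<close>, \<open>y\<close> congruent to 1, 2 modulo 7. For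
  the \<open>j\<close> of the theorem, the prime \<open>p\<close>, which is 3 modulo 4, divides \<open>s\<close> to an odd power, and
  there are no representations at all.
\<close>

text \<open>These simplification rules would turn arithmetic in \<open>bit\<close> into bitwise operations.\<close>

declare add_bit_eq_xor [simp del] mult_bit_eq_and [simp del]

section \<open>Dilations and sections of power series\<close>

text \<open>The operator \<open>U_d\<close> from the theory of modular forms.\<close>

definition fps_section :: "nat \<Rightarrow> 'a::zero fps \<Rightarrow> 'a fps" where
  "fps_section d f = Abs_fps (\<lambda>n. fps_nth f (d * n))"

lemma fps_section_nth [simp]: "fps_nth (fps_section d f) n = fps_nth f (d * n)"
  by (simp add: fps_section_def)

lemma fps_compose_X_power_nth:
  fixes f :: "'a::comm_ring_1 fps"
  assumes "d > 0"
  shows "fps_nth (f oo fps_X ^ d) n = (if d dvd n then fps_nth f (n div d) else 0)"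
proof -
  have "fps_nth (f oo fps_X ^ d) n = (\<Sum>i=0..n. if n = d * i then fps_nth f i else 0)"
    by (auto simp: fps_compose_nth fps_X_power_nth simp flip: power_mult intro!: sum.cong)
  also have "\<dots> = (\<Sum>i\<in>{i\<in>{0..n}. n = d * i}. fps_nth f i)"
    by (rule sum.inter_filter [symmetric]) simp
  also have "{i\<in>{0..n}. n = d * i} = (if d dvd n then {n div d} else {})"
    using assms by auto
  finally show ?thesis by simp
qed

text \<open>At exponents divisible by \<open>d\<close>, a series in \<open>q^d\<close> meets only
  the coefficients of \<open>f\<close> at multiples of \<open>d\<close>, so it factors out of the
  section and loses its dilation.\<close>

lemma fps_section_mult_compose:
  fixes f g :: "'a::comm_ring_1 fps"
  assumes d: "d > 0"
  shows "fps_section d (f * (g oo fps_X ^ d)) = fps_section d f * g"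
proof (rule fps_ext)
  fix n
  let ?h = "\<lambda>i. fps_nth f (d * n - i) * fps_nth (g oo fps_X ^ d) i"
  have "fps_nth ((g oo fps_X ^ d) * f) (d * n) = (\<Sum>i=0..d * n. ?h i)"
    by (simp add: fps_mult_nth mult.commute [of "fps_nth f _"])
  also have "\<dots> = (\<Sum>i\<in>(*) d ` {0..n}. ?h i)"
    using d by (intro sum.mono_neutral_right) (auto simp: fps_compose_X_power_nth elim!: dvdE)
  also have "\<dots> = (\<Sum>i=0..n. ?h (d * i))"
    using d by (subst sum.reindex) (auto simp: inj_on_def)
  also have "\<dots> = fps_nth (g * fps_section d f) n"
    using d by (simp add: fps_mult_nth fps_compose_X_power_nth mult.commute right_diff_distrib')
  finally show "fps_nth (fps_section d (f * (g oo fps_X ^ d))) n = fps_nth (fps_section d f * g) n"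
    by (simp add: mult.commute)
qed

text \<open>In the convolution the terms at \<open>i\<close> and \<open>n - i\<close> coincide and
  cancel in pairs modulo 2. Only the middle term survives, and each element of \<open>bit\<close> is
  its own square.\<close>

lemma fps_square_bit:
  fixes f :: "bit fps"
  shows "f ^ 2 = f oo fps_X ^ 2"
proof (rule fps_ext)
  fix n
  let ?h = "\<lambda>i. fps_nth f i * fps_nth f (n - i)"
  let ?O = "{i\<in>{0..n}. 2 * i \<noteq> n}" and ?D = "{i\<in>{0..n}. 2 * i = n}"
  have "fps_nth (f ^ 2) n = (\<Sum>i\<in>?O \<union> ?D. ?h i)"
    by (auto simp: power2_eq_square fps_mult_nth intro!: sum.cong)
  also have "\<dots> = (\<Sum>i\<in>?O. ?h i) + (\<Sum>i\<in>?D. ?h i)"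
    by (rule sum.union_disjoint) auto
  also have "(\<Sum>i\<in>?O. ?h i) = 0"
    by (rule sum_involution_eq_0 [where h = "\<lambda>i. n - i"]) (auto simp: mult.commute)
  also have "?D = (if even n then {n div 2} else {})"
    by auto
  finally show "fps_nth (f ^ 2) n = fps_nth (f oo fps_X ^ 2) n"
    by (cases "fps_nth f (n div 2)") (auto simp: fps_compose_X_power_nth elim!: evenE)
qed

lemma fps_compose_X_power_power:
  fixes f :: "'a::comm_ring_1 fps"
  assumes "d > 0" "e > 0"
  shows "f oo fps_X ^ d oo fps_X ^ e = f oo fps_X ^ (e * d)"
proof (rule fps_ext)
  fix n
  show "fps_nth (f oo fps_X ^ d oo fps_X ^ e) n = fps_nth (f oo fps_X ^ (e * d)) n"
    using assms
    by (cases "e dvd n") (auto simp: fps_compose_X_power_nth dest: dvd_mult_left elim!: dvdE)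
qed

lemma fps_power_4_bit:
  fixes f :: "bit fps"
  shows "f ^ 4 = f oo fps_X ^ 4"
proof -
  have "f ^ 4 = (f ^ 2) ^ 2" by (simp flip: power_mult)
  also have "\<dots> = f oo fps_X ^ (2 * 2)"
    unfolding fps_square_bit[of f] fps_square_bit[of "f oo fps_X ^ 2"]
    by (rule fps_compose_X_power_power) simp_all
  finally show ?thesis by simp
qed

lemma fps_power_8_bit:
  fixes f :: "bit fps"
  shows "f ^ 8 = f oo fps_X ^ 8"
proof -
  have "f ^ 8 = (f ^ 4) ^ 2" by (simp flip: power_mult)
  also have "\<dots> = f oo fps_X ^ (2 * 4)"
    unfolding fps_power_4_bit[of f] fps_square_bit[of "f oo fps_X ^ 4"]
    by (rule fps_compose_X_power_power) simp_all
  finally show ?thesis by simp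
qed

section \<open>Counting series\<close>

text \<open>Since \<open>card\<close> is 0 on infinite sets, an infinite fibre would count as 0;
  hence the finiteness assumptions in \<open>count_fps_mult\<close>.\<close>

definition count_fps :: "('a \<Rightarrow> nat) \<Rightarrow> 'a set \<Rightarrow> 'b::comm_ring_1 fps" where
  "count_fps w S = Abs_fps (\<lambda>n. of_nat (card {x \<in> S. w x = n}))"

lemma count_fps_nth: "fps_nth (count_fps w S) n = of_nat (card {x \<in> S. w x = n})"
  by (simp add: count_fps_def)

lemma count_fps_mult:
  assumes "\<And>n. finite {x \<in> S. w x = n}" "\<And>n. finite {y \<in> T. v y = n}"
  shows "count_fps w S * count_fps v T = count_fps (\<lambda>(x, y). w x + v y) (S \<times> T)"
proof (rule fps_ext)
  fix n
  have "{z \<in> S \<times> T. (case z of (x, y) \<Rightarrow> w x + v y) = n} =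
      (\<Union>i\<in>{0..n}. {x \<in> S. w x = i} \<times> {y \<in> T. v y = n - i})"
    by auto
  also have "card \<dots> = (\<Sum>i=0..n. card {x \<in> S. w x = i} * card {y \<in> T. v y = n - i})"
    using assms by (subst card_UN_disjoint) (auto simp: card_cartesian_product)
  finally show "fps_nth (count_fps w S * count_fps v T) n =
      fps_nth (count_fps (\<lambda>(x, y). w x + v y) (S \<times> T)) n"
    by (simp add: count_fps_nth fps_mult_nth)
qed

lemma count_fps_compose:
  assumes "d > 0"
  shows "count_fps w S oo fps_X ^ d = count_fps (\<lambda>x. d * w x) S"
proof (rule fps_ext)
  fix n
  have "{x \<in> S. d * w x = n} = (if d dvd n then {x \<in> S. w x = n div d} else {})"
    using assms by auto
  then show "fps_nth (count_fps w S oo fps_X ^ d) n = fps_nth (count_fps (\<lambda>x. d * w x) S) n"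
    by (simp add: fps_compose_X_power_nth[OF assms] count_fps_nth)
qed

text \<open>Turns a change of variables \<open>h\<close> on the elements of weight divisible by
  \<open>d\<close> into an identity of series.\<close>

lemma fps_section_count_fps:
  assumes "bij_betw h T {x \<in> S. d dvd w x}" "\<And>x. x \<in> T \<Longrightarrow> w (h x) = d * v x" "d > 0"
  shows "fps_section d (count_fps w S) = count_fps v T"
proof (rule fps_ext)
  fix n
  have "bij_betw h {x \<in> T. v x = n} {x \<in> S. w x = d * n}"
    unfolding bij_betw_def
  proof
    show "inj_on h {x \<in> T. v x = n}"
      using bij_betw_imp_inj_on[OF assms(1)] by (rule inj_on_subset) auto
    show "h ` {x \<in> T. v x = n} = {x \<in> S. w x = d * n}"
    proof (intro equalityI subsetI)
      fix y assume y: "y \<in> {x \<in> S. w x = d * n}"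
      then have "y \<in> h ` T" using bij_betw_imp_surj_on[OF assms(1)] by auto
      then show "y \<in> h ` {x \<in> T. v x = n}" using y assms(2,3) by auto
    qed (use bij_betw_imp_surj_on[OF assms(1)] assms(2) in auto)
  qed
  from bij_betw_same_card[OF this]
  show "fps_nth (fps_section d (count_fps w S)) n = fps_nth (count_fps v T) n"
    by (simp add: count_fps_nth)
qed

lemma count_fps_reindex:
  assumes "bij_betw h T S" "\<And>x. x \<in> T \<Longrightarrow> w (h x) = v x"
  shows "(count_fps w S :: 'b::comm_ring_1 fps) = count_fps v T"
proof -
  have "fps_section 1 (count_fps w S :: 'b fps) = count_fps v T"
    by (rule fps_section_count_fps[of h]) (simp_all add: assms)
  moreover have "fps_section 1 f = f" for f :: "'b fps"
    by (rule fps_ext) simp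
  ultimately show ?thesis by simp
qed

lemma fps_X_power_mult_count_fps:
  "fps_X ^ d * count_fps w S = count_fps (\<lambda>x. w x + d) S"
proof (rule fps_ext)
  fix n
  have "{x \<in> S. w x + d = n} = (if n < d then {} else {x \<in> S. w x = n - d})"
    by auto
  then show "fps_nth (fps_X ^ d * count_fps w S) n = fps_nth (count_fps (\<lambda>x. w x + d) S) n"
    by (simp add: fps_X_power_mult_nth count_fps_nth)
qed

section \<open>Squares in residue classes modulo 7\<close>

definition class7 :: "int \<Rightarrow> int set" where
  "class7 r = {x. [x = r] (mod 7)}"

text \<open>The series \<open>A_r\<close> of the overview.\<close>

definition theta7 :: "int \<Rightarrow> bit fps" where
  "theta7 r = count_fps (\<lambda>x. nat (x ^ 2)) (class7 r)"

lemma finite_square_fibre: "finite {x \<in> S. nat ((x::int) ^ 2) = n}"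
proof (rule finite_subset)
  show "{x \<in> S. nat (x ^ 2) = n} \<subseteq> {- int n..int n}"
  proof (clarify)
    fix x :: int
    have "\<bar>x\<bar> * 1 \<le> \<bar>x\<bar> * \<bar>x\<bar>"
      by (cases "x = 0") (simp, intro mult_left_mono, auto)
    then have "\<bar>x\<bar> \<le> x ^ 2" by (simp add: power2_eq_square)
    then show "x \<in> {- int (nat (x ^ 2))..int (nat (x ^ 2))}" by (simp add: abs_le_iff)
  qed
qed simp

text \<open>The reflection of \<open>x\<close> to \<open>-x\<close> swaps the two classes and
  preserves squares.\<close>

lemma theta7_neg:
  assumes "[r + s = 0] (mod 7)"
  shows "theta7 r = theta7 s"
  unfolding theta7_def
proof (rule count_fps_reindex)
  have "(- x \<in> class7 s) = (x \<in> class7 r)" for x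
  proof -
    have "7 dvd r + s" using assms by (simp add: cong_0_iff)
    moreover have "- x - s = - (x - r) - (r + s)" by simp
    ultimately have "7 dvd - x - s \<longleftrightarrow> 7 dvd - (x - r)"
      by (simp only: dvd_diff_left_iff)
    then have "[- x = s] (mod 7) \<longleftrightarrow> [x = r] (mod 7)"
      unfolding cong_iff_dvd_diff dvd_minus_iff .
    then show ?thesis by (simp add: class7_def)
  qed
  then show "bij_betw uminus (class7 s) (class7 r)"
    by (intro bij_betwI[where g = uminus]) (force simp: minus_minus)+
qed simp

lemma theta7_mult:
  "theta7 r * theta7 s = count_fps (\<lambda>(x, y). nat (x ^ 2) + nat (y ^ 2)) (class7 r \<times> class7 s)"
  unfolding theta7_def by (intro count_fps_mult finite_square_fibre)

lemma finite_scaled_square_fibre: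
  assumes "d > 0"
  shows "finite {x \<in> S. d * nat ((x::int) ^ 2) = n}"
  by (rule finite_subset[OF _ finite_square_fibre[of S "n div d"]]) (use assms in auto)

lemma finite_two_squares_fibre:
  assumes "d > 0" "e > 0"
  shows "finite {z \<in> S \<times> T. (case z of (x, y) \<Rightarrow> d * nat ((x::int) ^ 2) + e * nat ((y::int) ^ 2)) = n}"
proof (rule finite_subset)
  show "{z \<in> S \<times> T. (case z of (x, y) \<Rightarrow> d * nat (x ^ 2) + e * nat (y ^ 2)) = n} \<subseteq>
      (\<Union>i\<in>{0..n}. {x \<in> S. d * nat (x ^ 2) = i} \<times> {y \<in> T. e * nat (y ^ 2) = n - i})"
    by auto
qed (use assms finite_scaled_square_fibre in blast)

text \<open>Serves twice: with weights 1, 2, 4 before the change of variables and 1, 1, 1 after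
  it.\<close>

lemma theta7_mult3:
  assumes "d > 0" "e > 0" "f > 0"
  shows "(count_fps (\<lambda>x. d * nat (x ^ 2)) (class7 r) :: 'b::comm_ring_1 fps) *
      count_fps (\<lambda>x. e * nat (x ^ 2)) (class7 s) *
      count_fps (\<lambda>x. f * nat (x ^ 2)) (class7 t) =
    count_fps (\<lambda>((x, y), z). d * nat (x ^ 2) + e * nat (y ^ 2) + f * nat (z ^ 2))
      ((class7 r \<times> class7 s) \<times> class7 t)"
proof -
  have "(count_fps (\<lambda>x. d * nat (x ^ 2)) (class7 r) :: 'b fps) *
      count_fps (\<lambda>x. e * nat (x ^ 2)) (class7 s) =
      count_fps (\<lambda>(x, y). d * nat (x ^ 2) + e * nat (y ^ 2)) (class7 r \<times> class7 s)"
    by (rule count_fps_mult)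
      (rule finite_scaled_square_fibre[OF assms(1)] finite_scaled_square_fibre[OF assms(2)])+
  also have "\<dots> * count_fps (\<lambda>x. f * nat (x ^ 2)) (class7 t) = count_fps
      (\<lambda>(p, z). (case p of (x, y) \<Rightarrow> d * nat (x ^ 2) + e * nat (y ^ 2)) + f * nat (z ^ 2))
      ((class7 r \<times> class7 s) \<times> class7 t)"
    by (rule count_fps_mult)
      (rule finite_two_squares_fibre[OF assms(1,2)] finite_scaled_square_fibre[OF assms(3)])+
  finally show ?thesis by (simp add: case_prod_beta')
qed

text \<open>Repeated halving: first \<open>a\<close> is even, then \<open>b\<close> is even, and
  finally \<open>a/2\<close> and \<open>c\<close> have the same parity.\<close>

lemma eight_dvd_form:
  fixes a b c :: int
  assumes "8 dvd a ^ 2 + 2 * b ^ 2 + 4 * c ^ 2"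
  shows "even b" "4 dvd a - 2 * c"
proof -
  obtain k where k: "a ^ 2 + 2 * b ^ 2 + 4 * c ^ 2 = 8 * k" using assms by (rule dvdE)
  then have "a ^ 2 = 2 * (4 * k - b ^ 2 - 2 * c ^ 2)" by (simp add: algebra_simps)
  then have "even (a ^ 2)" by (metis dvd_triv_left)
  then obtain a' where a: "a = 2 * a'" by auto
  have "b ^ 2 = 2 * (2 * k - a' ^ 2 - c ^ 2)" using k by (simp add: a)
  then have "even (b ^ 2)" by (metis dvd_triv_left)
  then show "even b" by simp
  then obtain b' where b: "b = 2 * b'" by auto
  have "a' ^ 2 + c ^ 2 = 2 * (k - b' ^ 2)" using k by (simp add: a b)
  then have "even (a' ^ 2 + c ^ 2)" by (metis dvd_triv_left)
  then have "even (a' - c)" by simp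
  then show "4 dvd a - 2 * c" unfolding a by presburger
qed

text \<open>
  If \<open>8\<close> divides \<open>a\<^sup>2 + 2b\<^sup>2 + 4c\<^sup>2\<close> then \<open>a = 2(u + v)\<close>, \<open>b = 2w\<close>, \<open>c = u - v\<close>,
  and the form becomes \<open>8(u\<^sup>2 + v\<^sup>2 + w\<^sup>2)\<close>.
\<close>

lemma fps_section_theta7_power_7:
  "fps_section 8 (theta7 3 ^ 7) = theta7 1 * theta7 2 * theta7 3"
proof -
  let ?h = "\<lambda>((u, v), w). ((2 * (u + v), 2 * w), u - v) :: (int \<times> int) \<times> int"
  \<comment> \<open>The inverse substitution: \<open>a - 2c = 4v\<close>, \<open>u = c + v\<close>
    and \<open>b = 2w\<close>.\<close>
  let ?g = "\<lambda>((a, b), c). ((c + (a - 2 * c) div 4, (a - 2 * c) div 4), b div 2) :: (int \<times> int) \<times> int"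
  \<comment> \<open>Solving \<open>2(u + v) = u - v = 2w = 3\<close> modulo 7 gives
    \<open>u = 4\<close>, \<open>v = 1\<close>, \<open>w = 5\<close>.\<close>
  let ?T = "(class7 4 \<times> class7 1) \<times> class7 5"
  let ?S = "(class7 3 \<times> class7 3) \<times> class7 3"
  let ?w = "\<lambda>((x, y), z). 1 * nat (x ^ 2) + 2 * nat (y ^ 2) + 4 * nat (z ^ 2)"
  let ?v = "\<lambda>((x, y), z). 1 * nat (x ^ 2) + 1 * nat (y ^ 2) + 1 * nat (z ^ 2)"
  have w: "?w (?h x) = 8 * ?v x" for x
  proof -
    obtain a b c where x: "x = ((a, b), c)" by (metis prod.exhaust)
    have "int (?w (?h x)) = int (8 * ?v x)"
      unfolding x by simp (simp add: power2_eq_square algebra_simps)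
    then show ?thesis by linarith
  qed
  \<comment> \<open>Since 7 = 1 + 2 + 4, Frobenius turns the factors into dilations, which gives the
    weights 1, 2, 4.\<close>
  have "theta7 3 ^ 7 = theta7 3 * theta7 3 ^ 2 * theta7 3 ^ 4"
    by (simp flip: power_add power_Suc)
  also have "\<dots> = count_fps ?w ?S"
    unfolding fps_square_bit[of "theta7 3"] fps_power_4_bit[of "theta7 3"]
    using theta7_mult3[of 1 2 4 3 3 3, where 'b = bit] by (simp add: theta7_def count_fps_compose)
  finally have *: "theta7 3 ^ 7 = count_fps ?w ?S" .
  have "fps_section 8 (count_fps ?w ?S :: bit fps) = count_fps ?v ?T"
  proof (rule fps_section_count_fps)
    show "bij_betw ?h ?T {x \<in> ?S. 8 dvd ?w x}"
    proof (rule bij_betwI[where g = ?g])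
      show "?h \<in> ?T \<rightarrow> {x \<in> ?S. 8 dvd ?w x}"
      proof
        fix x assume "x \<in> ?T"
        then obtain u v w where x: "x = ((u, v), w)"
            and uvw: "[u = 4] (mod 7)" "[v = 1] (mod 7)" "[w = 5] (mod 7)"
          by (auto simp: class7_def)
        have "[2 * (u + v) = 2 * (4 + 1)] (mod 7)" "[u - v = 4 - 1] (mod 7)" "[2 * w = 2 * 5] (mod 7)"
          by - (rule cong_scalar_left cong_add cong_diff uvw)+
        then have "?h x \<in> ?S" unfolding x by (simp add: class7_def cong_def)
        then show "?h x \<in> {x \<in> ?S. 8 dvd ?w x}" using w[of x] by simp
      qed
      have S: "\<exists>c v w. x = ((2 * c + 4 * v, 2 * w), c) \<and> [2 * c + 4 * v = 3] (mod 7) \<and>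
          [2 * w = 3] (mod 7) \<and> [c = 3] (mod 7)" if x: "x \<in> {x \<in> ?S. 8 dvd ?w x}" for x
      proof -
        obtain a b c where abc: "x = ((a, b), c)" by (metis prod.exhaust)
        have "int 8 dvd int (?w ((a, b), c))" using x unfolding of_nat_dvd_iff abc by simp
        then have "even b" "4 dvd a - 2 * c" using eight_dvd_form[of a b c] by simp_all
        then obtain v w where "a - 2 * c = 4 * v" "b = 2 * w" by (elim dvdE)
        moreover from this have "a = 2 * c + 4 * v" by simp
        ultimately show ?thesis using x unfolding abc by (auto simp: class7_def)
      qed
      show "?g \<in> {x \<in> ?S. 8 dvd ?w x} \<rightarrow> ?T"
      proof
        fix x assume "x \<in> {x \<in> ?S. 8 dvd ?w x}"
        from S[OF this] obtain c v w where x: "x = ((2 * c + 4 * v, 2 * w), c)"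
          and cvw: "[2 * c + 4 * v = 3] (mod 7)" "[2 * w = 3] (mod 7)" "[c = 3] (mod 7)" by blast
        from cvw(1,3) have v: "[v = 1] (mod 7)" unfolding cong_def by simp presburger
        moreover from cvw(2) have "[w = 5] (mod 7)" unfolding cong_def by simp presburger
        moreover have "[c + v = 3 + 1] (mod 7)" using cvw(3) v by (rule cong_add)
        ultimately show "?g x \<in> ?T" unfolding x by (simp add: class7_def)
      qed
      show "?g (?h x) = x" for x
      proof -
        obtain u v w where x: "x = ((u, v), w)" by (metis prod.exhaust)
        have "2 * (u + v) - 2 * (u - v) = 4 * v" by simp
        then show ?thesis unfolding x by simp
      qed
      show "?h (?g x) = x" if x: "x \<in> {x \<in> ?S. 8 dvd ?w x}" for x
        using S[OF x] by auto
    qed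
  qed (use w in simp_all)
  also have "\<dots> = theta7 4 * theta7 1 * theta7 5"
    using theta7_mult3[of 1 1 1 4 1 5, where 'b = bit] by (simp add: theta7_def)
  also have "theta7 4 = theta7 3" by (rule theta7_neg) (simp add: cong_def)
  also have "theta7 5 = theta7 2" by (rule theta7_neg) (simp add: cong_def)
  finally show ?thesis by (simp add: * mult_ac)
qed

section \<open>Reduction of the coefficients modulo 2\<close>

lemma of_int_bit_eq_0_iff: "(of_int z :: bit) = 0 \<longleftrightarrow> even z"
  by (cases "even z") (auto elim!: evenE oddE)

text \<open>Modulo 2 both the alternating signs and the minus sign between the two halves disappear,
  leaving an ordinary theta series.\<close>

lemma false_theta_fps_mod_2:
  assumes "r > 0" "s > 0"
  shows "Abs_fps (\<lambda>i. of_int (fps_nth (false_theta_fps r s) i)) = (count_fps (theta_exp r s) UNIV :: bit fps)"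
proof (rule fps_ext)
  fix i
  let ?P = "{n. n \<ge> 0 \<and> theta_exp r s n = i}" and ?N = "{n. n < 0 \<and> theta_exp r s n = i}"
  have minus: "a - b = a + b" for a b :: bit
    by (cases a; cases b) simp_all
  have fin: "finite ?P" "finite ?N"
    using finite_theta_exp[OF assms, of i] by (auto elim: rev_finite_subset)
  have "(of_int (fps_nth (false_theta_fps r s) i) :: bit) = of_nat (card ?P) + of_nat (card ?N)"
    unfolding false_theta_fps_nth[OF assms] by (simp add: minus)
  also have "\<dots> = of_nat (card (?P \<union> ?N))"
    using fin by (subst card_Un_disjoint) auto
  also have "?P \<union> ?N = {n. theta_exp r s n = i}" by auto
  finally show "fps_nth (Abs_fps (\<lambda>i. of_int (fps_nth (false_theta_fps r s) i))) i =
      fps_nth (count_fps (theta_exp r s) UNIV :: bit fps) i"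
    by (simp add: count_fps_nth)
qed

lemma c_coeff_mod_2:
  assumes "r > 0" "s > 0"
  shows "Abs_fps (\<lambda>i. of_int (c_coeff r s i)) * (count_fps (theta_exp r s) UNIV :: bit fps) = 1"
proof -
  have "Abs_fps (\<lambda>i. of_int (c_coeff r s i)) *
      Abs_fps (\<lambda>i. of_int (fps_nth (false_theta_fps r s) i)) =
      (Abs_fps (\<lambda>i. of_int (fps_nth (Abs_fps (c_coeff r s) * false_theta_fps r s) i)) :: bit fps)"
    by (rule fps_ext) (simp add: fps_mult_nth)
  also have "\<dots> = 1"
    unfolding Abs_fps_c_coeff[OF assms] by (rule fps_ext) simp
  finally show ?thesis unfolding false_theta_fps_mod_2[OF assms] .
qed

lemma theta_exp_13_1: "int (7 * theta_exp 13 1 n + 9) = (7 * n + 3) ^ 2"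
proof -
  let ?x = "n * (n + 1) div 2" and ?y = "n * (n - 1) div 2"
  have 2: "2 * ?x = n * (n + 1)" "2 * ?y = n * (n - 1)" by auto
  have "0 \<le> n * (n + 1)" "0 \<le> n * (n - 1)"
    by (auto simp: zero_le_mult_iff)
  then have "int (theta_exp 13 1 n) = 13 * ?x + ?y"
    unfolding theta_exp_def by simp
  then have "2 * int (theta_exp 13 1 n) = 13 * (n * (n + 1)) + n * (n - 1)"
    using 2 by linarith
  then have "int (theta_exp 13 1 n) = 7 * (n * n) + 6 * n"
    by (simp add: algebra_simps)
  then show ?thesis by (simp add: power2_eq_square algebra_simps)
qed

text \<open>The numbers \<open>7n + 3\<close> run through the class of 3, and their squares are the
  completed squares of \<open>theta_exp_13_1\<close>.\<close>

lemma theta7_3_eq: "theta7 3 = fps_X ^ 9 * (count_fps (theta_exp 13 1) UNIV oo fps_X ^ 7)"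
proof -
  have "theta7 3 = count_fps (\<lambda>n. 7 * theta_exp 13 1 n + 9) UNIV"
    unfolding theta7_def
  proof (rule count_fps_reindex)
    show "bij_betw (\<lambda>n. 7 * n + 3) UNIV (class7 3)"
      by (rule bij_betwI[where g = "\<lambda>x. (x - 3) div 7"]) (auto simp: class7_def cong_def, presburger)
    show "nat ((7 * n + 3) ^ 2) = 7 * theta_exp 13 1 n + 9" for n
      unfolding theta_exp_13_1 [symmetric] by simp
  qed
  then show ?thesis by (simp add: fps_X_power_mult_count_fps count_fps_compose)
qed

lemma c_coeff_13_1_mod_2:
  assumes "7 * j = 8 * s + 9"
  shows "(of_int (c_coeff 13 1 j) :: bit) =
    of_nat (card {(x, y) \<in> class7 1 \<times> class7 2. x ^ 2 + y ^ 2 = int s})"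
proof -
  define C :: "bit fps" where "C = Abs_fps (\<lambda>i. of_int (c_coeff 13 1 i))"
  \<comment> \<open>The extra factor \<open>q^7\<close> raises the right-hand side
    \<open>q^9\<close> to \<open>q^16\<close>, a series in \<open>q^8\<close> that can be taken out
    of the section.\<close>
  define D where "D = fps_X ^ 7 * (C oo fps_X ^ 7)"
  have "(C oo fps_X ^ 7) * (count_fps (theta_exp 13 1) UNIV oo fps_X ^ 7) =
      C * count_fps (theta_exp 13 1) UNIV oo fps_X ^ 7"
    by (rule fps_compose_mult_distrib [symmetric]) simp
  also have "\<dots> = 1"
    unfolding C_def by (simp add: c_coeff_mod_2)
  finally have "D * theta7 3 = fps_X ^ 7 * fps_X ^ 9"
    unfolding D_def theta7_3_eq by (simp add: mult_ac)
  also have "\<dots> = fps_X ^ 2 oo fps_X ^ 8"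
    by (simp add: fps_X_power_compose flip: power_add power_mult)
  finally have D: "D * theta7 3 = fps_X ^ 2 oo fps_X ^ 8" .
  \<comment> \<open>Allows \<open>theta7 3\<close> to be cancelled below, as \<open>bit fps\<close>
    has no zero divisors.\<close>
  then have nz: "theta7 3 \<noteq> 0" by (auto simp: fps_X_power_compose)
  have "D * (theta7 3 oo fps_X ^ 8) = D * (theta7 3 * theta7 3 ^ 7)"
    by (simp flip: fps_power_8_bit power_Suc)
  also have "\<dots> = theta7 3 ^ 7 * (fps_X ^ 2 oo fps_X ^ 8)"
    by (simp flip: D)
  finally have "fps_section 8 (D * (theta7 3 oo fps_X ^ 8)) =
      fps_section 8 (theta7 3 ^ 7 * (fps_X ^ 2 oo fps_X ^ 8))"
    by simp
  then have "fps_section 8 D * theta7 3 = (theta7 1 * theta7 2 * fps_X ^ 2) * theta7 3"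
    by (simp add: fps_section_mult_compose fps_section_theta7_power_7 mult_ac)
  then have "fps_section 8 D = theta7 1 * theta7 2 * fps_X ^ 2"
    using nz by simp
  \<comment> \<open>Index \<open>s + 2\<close> of the section is index \<open>8s + 16\<close> of
    \<open>D\<close>; removing \<open>q^7\<close> leaves \<open>8s + 9 = 7j\<close>.\<close>
  then have "fps_nth (fps_section 8 D) (s + 2) = fps_nth (theta7 1 * theta7 2 * fps_X ^ 2) (s + 2)"
    by simp
  then have "fps_nth (C oo fps_X ^ 7) (8 * s + 9) = fps_nth (theta7 1 * theta7 2) s"
    by (simp add: D_def fps_X_power_mult_nth fps_X_power_mult_right_nth add.commute)
  also have "fps_nth (C oo fps_X ^ 7) (8 * s + 9) = of_int (c_coeff 13 1 j)"
    unfolding assms [symmetric] by (simp add: fps_compose_X_power_nth C_def)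
  also have "fps_nth (theta7 1 * theta7 2) s =
      of_nat (card {(x, y) \<in> class7 1 \<times> class7 2. x ^ 2 + y ^ 2 = int s})"
  proof -
    have "nat (x ^ 2) + nat (y ^ 2) = s \<longleftrightarrow> x ^ 2 + y ^ 2 = int s" for x y :: int
      by (subst of_nat_eq_iff [symmetric, where 'a = int]) simp
    then show ?thesis by (simp add: theta7_mult count_fps_nth case_prod_beta' mem_Times_iff)
  qed
  finally show ?thesis .
qed

section \<open>Sums of two squares\<close>

text \<open>Otherwise \<open>p\<close> divides neither \<open>x\<close> nor \<open>y\<close>, and
  raising \<open>x^2 = -y^2\<close> modulo \<open>p\<close> to the odd power
  \<open>(p - 1)/2\<close> yields \<open>1 = -1\<close> by Fermat.\<close>

lemma prime_dvd_sum_two_squares: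
  fixes x y :: int and p :: nat
  assumes "prime p" "[p = 3] (mod 4)" "int p dvd x ^ 2 + y ^ 2"
  shows "int p dvd x"
proof (rule ccontr)
  assume x: "\<not> int p dvd x"
  \<comment> \<open>Fermat's theorem is carried over from naturals through the absolute value, which
    the even exponent \<open>p - 1\<close> absorbs.\<close>
  have fermat: "[a ^ (p - 1) = 1] (mod int p)" if "\<not> int p dvd a" for a
  proof -
    have "\<not> p dvd nat \<bar>a\<bar>" using that by (simp add: nat_dvd_iff flip: int_dvd_int_iff)
    from fermat_theorem[OF assms(1) this] have "[int (nat \<bar>a\<bar> ^ (p - 1)) = int 1] (mod int p)"
      by (simp only: cong_int_iff)
    moreover have "even (p - 1)" using assms(2) by (simp add: cong_def) presburger
    ultimately show ?thesis by (simp add: power_even_abs)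
  qed
  obtain h where h: "p - 1 = 2 * h" "odd h"
  proof -
    have "odd ((p - 1) div 2)" "p - 1 = 2 * ((p - 1) div 2)"
      using assms(2) by (simp_all add: cong_def) presburger+
    then show thesis using that by blast
  qed
  have "[x ^ 2 = - (y ^ 2)] (mod int p)"
    using assms(3) by (simp add: cong_iff_dvd_diff)
  then have "[(x ^ 2) ^ h = (- (y ^ 2)) ^ h] (mod int p)" by (rule cong_pow)
  then have eq: "[x ^ (p - 1) = - (y ^ (p - 1))] (mod int p)"
    using h by (simp add: power_mult)
  have y: "\<not> int p dvd y"
  proof
    assume "int p dvd y"
    then have "int p dvd x ^ 2" using assms(3) by (simp add: dvd_add_left_iff power2_eq_square)
    then show False using x assms(1) by (simp add: prime_dvd_power)
  qed
  have "[1 = - 1] (mod int p)"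
    using fermat[OF x] fermat[OF y] eq by (metis cong_minus_minus_iff cong_sym cong_trans)
  then have "int p dvd 2" by (simp add: cong_iff_dvd_diff)
  then have "p \<le> 2" by (auto dest: zdvd_imp_le)
  then show False using assms(2) by (auto simp: cong_def le_Suc_eq numeral_2_eq_2)
qed

text \<open>Descent: by symmetry \<open>p\<close> divides both \<open>x\<close> and
  \<open>y\<close>, so \<open>p^2\<close> can be divided out.\<close>

lemma prime_square_mult_eq_sum_two_squares:
  fixes x y :: int
  assumes p: "prime p" "[p = 3] (mod 4)" and eq: "x ^ 2 + y ^ 2 = int (p ^ 2 * u)"
  obtains x' y' where "x' ^ 2 + y' ^ 2 = int u"
proof -
  have "int p dvd x ^ 2 + y ^ 2" "int p dvd y ^ 2 + x ^ 2"
    unfolding add.commute[of "y ^ 2"] eq by (simp_all add: power2_eq_square)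
  from this[THEN prime_dvd_sum_two_squares[OF p]]
  obtain x' y' where xy: "x = int p * x'" "y = int p * y'" by (elim dvdE)
  have "int p ^ 2 * (x' ^ 2 + y' ^ 2) = int p ^ 2 * int u"
    using eq unfolding xy by (simp add: power_mult_distrib distrib_left)
  then show thesis using prime_gt_0_nat[OF p(1)] that by auto
qed

text \<open>Descent lowers the exponent of \<open>p\<close> by 2 down to 1, where \<open>p^2\<close>
  dividing the sum would force \<open>p\<close> to divide \<open>t\<close>.\<close>

lemma sum_two_squares_neq:
  fixes x y :: int
  assumes p: "prime p" "[p = 3] (mod 4)" and t: "\<not> p dvd t"
  shows "x ^ 2 + y ^ 2 \<noteq> int (p ^ (2 * m + 1) * t)"
proof (induction m arbitrary: x y)
  case (0 x y)
  show ?case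
  proof
    assume eq: "x ^ 2 + y ^ 2 = int (p ^ (2 * 0 + 1) * t)"
    have "int p dvd x ^ 2 + y ^ 2" "int p dvd y ^ 2 + x ^ 2"
      unfolding add.commute[of "y ^ 2"] eq by simp_all
    from this[THEN prime_dvd_sum_two_squares[OF p]]
    have "int p * int p dvd x ^ 2 + y ^ 2"
      unfolding power2_eq_square by (intro dvd_add mult_dvd_mono)
    then have "int p dvd int t" using eq prime_gt_0_nat[OF p(1)] by simp
    then show False using t by simp
  qed
next
  case (Suc m x y)
  show ?case
  proof
    assume "x ^ 2 + y ^ 2 = int (p ^ (2 * Suc m + 1) * t)"
    then have "x ^ 2 + y ^ 2 = int (p ^ 2 * (p ^ (2 * m + 1) * t))"
      by (simp add: power2_eq_square mult.assoc)
    then show False using prime_square_mult_eq_sum_two_squares[OF p] Suc.IH by blast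
  qed
qed

theorem theorem4p2:
  fixes p m n k :: nat
  assumes "prime p"
    and "[p = 15] (mod 28) \<or> [p = 27] (mod 28)"
    and "\<not> p dvd n"
  shows "[c_coeff 13 1 (2 ^ (3 * k + 3) * p ^ (2 * m + 1) * n
            + (5 * 2 ^ (3 * k + 3) * p ^ (2 * m + 2) + 9) div 7) = 0] (mod 2)"
proof -
  let ?j = "2 ^ (3 * k + 3) * p ^ (2 * m + 1) * n
            + (5 * 2 ^ (3 * k + 3) * p ^ (2 * m + 2) + 9) div 7"
  \<comment> \<open>Chosen so that \<open>7j - 9 = 8 p^(2m+1) t\<close> for the index
    \<open>j\<close> of the statement.\<close>
  let ?t = "2 ^ (3 * k) * (7 * n + 5 * p)"
  have mod_28: "p mod 28 = 15 \<or> p mod 28 = 27"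
    using assms(2) by (simp add: cong_def)
  have "p mod 4 = p mod 28 mod 4" "p mod 7 = p mod 28 mod 7"
    by (simp_all add: mod_mod_cancel)
  with mod_28 have "p mod 4 = 3" "p mod 7 \<noteq> 0" by auto
  then have p: "[p = 3] (mod 4)" and "p \<noteq> 2" "p \<noteq> 7"
    by (auto simp: cong_def)
  then have "\<not> p dvd 2" "\<not> p dvd 7"
    using primes_dvd_imp_eq[OF assms(1), of 2] primes_dvd_imp_eq[OF assms(1), of 7] by auto
  then have "\<not> p dvd 2 ^ (3 * k)" "\<not> p dvd 7 * n + 5 * p"
    using assms(1,3) prime_dvd_power[of p 2 "3 * k"]
    by (auto simp: prime_dvd_mult_iff dvd_add_left_iff)
  then have t: "\<not> p dvd ?t"
    using assms(1) by (simp add: prime_dvd_mult_iff)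
  have "7 * ?j = 7 * (2 ^ (3 * k + 3) * p ^ (2 * m + 1) * n) + (5 * 2 ^ (3 * k + 3) * p ^ (2 * m + 2) + 9)"
    using seven_dvd[OF assms(2), of k m] by (simp only: distrib_left dvd_mult_div_cancel)
  also have "\<dots> = 8 * (p ^ (2 * m + 1) * ?t) + 9"
    by (simp add: power_add algebra_simps power2_eq_square)
  finally have "(of_int (c_coeff 13 1 ?j) :: bit) =
      of_nat (card {(x, y) \<in> class7 1 \<times> class7 2. x ^ 2 + y ^ 2 = int (p ^ (2 * m + 1) * ?t)})"
    by (rule c_coeff_13_1_mod_2)
  also have "\<dots> = 0"
    using sum_two_squares_neq[OF assms(1) p t] by simp
  finally show ?thesis
    unfolding of_int_bit_eq_0_iff by (simp add: cong_0_iff)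
qed

end
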